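(* Let $k, n, d$ be positive integers with $n$ and $d$ coprime. Then there is an infinite partition of $[2kd,\infty)$ into infinite sets $Y$ for which $\sigma Y = n/d$ (that is, the partition has infinitely many members, and every member $Y$ is an infinite set with $\sigma Y = n/d$).
   Context: $\mathbf{N} = \{1,2,3,\ldots\}$. For a positive integer $x$, $[x,\infty)$ denotes the set of all integers $z \ge x$. For a set $Y \subseteq \mathbf{N}$, $\sigma Y := \sum_{y\in Y} \frac{1}{y}$, the sum of the reciprocals of the elements of $Y$ (possibly $\infty$). *)

theory Defs
  imports "HOL-Analysis.Analysis" "HOL-Library.Disjoint_Sets"
begin

text \<open>
  The reciprocal sum takes values in \<^typ>\<open>ennreal\<close>, where every sum of nonnegative terms exists,
  so it is \<^term>\<open>\<infinity> :: ennreal\<close> exactly when the series diverges. It is meant for sets of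
  positive integers; an element 0 would contribute nothing.
\<close>
definition recip_sum :: "nat set \<Rightarrow> ennreal" where
  "recip_sum Y = (\<Sum>\<^sub>\<infinity>y\<in>Y. ennreal (1 / real y))"

end

theory Submission
  imports Defs
begin

text \<open>
  A divergent series of positive terms that tend to zero has an infinite subseries with any
  prescribed positive sum \<open>t\<close>, so no arithmetic of reciprocals is involved: hitting \<open>n / d\<close>
  exactly is as easy as hitting any other positive real. The subseries comes from the greedy rule:
  run through the indices in increasing order and accept a term whenever the running total stays
  strictly below \<open>t\<close> (\<open>subseries_with_prescribed_sum\<close>).

  Such subseries are now removed from \<open>[M, \<infinity>)\<close> one after the other. Removing a set with finite
  sum leaves a set with divergent sum, so the process never stops. Each removed set is made to
  contain the least remaining number \<open>m\<close>, the greedy rule being applied to the rest with target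
  \<open>t - 1 / m\<close>; hence every number is eventually removed. The only thing required is that \<open>m\<close> alone
  does not exhaust the target, and on \<open>[2kd, \<infinity>)\<close> indeed \<open>1 / m \<le> 1 / (2kd) < n / d\<close>.
\<close>

section \<open>Subseries with a prescribed sum\<close>

text \<open>
  The running total of the greedy rule before index \<open>n\<close> is examined. The strict inequality
  keeps the total from ever reaching \<open>t\<close>, which makes the accepted set infinite.
\<close>
fun greedy_total :: "(nat \<Rightarrow> real) \<Rightarrow> nat set \<Rightarrow> real \<Rightarrow> nat \<Rightarrow> real" where
  "greedy_total f A t 0 = 0"
| "greedy_total f A t (Suc n) =
    (if n \<in> A \<and> greedy_total f A t n + f n < t then greedy_total f A t n + f n
     else greedy_total f A t n)"

definition greedy_set :: "(nat \<Rightarrow> real) \<Rightarrow> nat set \<Rightarrow> real \<Rightarrow> nat set" where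
  "greedy_set f A t = {n \<in> A. greedy_total f A t n + f n < t}"

lemma greedy_total_less:
  assumes "t > 0"
  shows "greedy_total f A t n < t"
  using assms by (induction n) auto

lemma greedy_total_eq_sum:
  "greedy_total f A t n = (\<Sum>i<n. if i \<in> greedy_set f A t then f i else 0)"
  by (induction n) (auto simp: greedy_set_def)

text \<open>
  The greedy totals increase to some \<open>L \<le> t\<close>. If \<open>L < t\<close>, then every late term is smaller than
  \<open>t - L\<close> and is accepted, so only finitely many terms are rejected and the whole series converges.
  If finitely many terms were accepted, then \<open>t\<close> would be one of the totals, which all lie below it.
\<close>
lemma subseries_with_prescribed_sum:
  fixes f :: "nat \<Rightarrow> real"
  assumes pos: "\<And>a. a \<in> A \<Longrightarrow> f a > 0"
    and lim: "f \<longlonglongrightarrow> 0"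
    and div: "\<not> f summable_on A"
    and t: "t > 0"
  obtains Y where "Y \<subseteq> A" "infinite Y" "(f has_sum t) Y"
proof
  let ?Y = "greedy_set f A t"
  let ?g = "\<lambda>i. if i \<in> ?Y then f i else 0"
  let ?s = "greedy_total f A t"
  show sub: "?Y \<subseteq> A" by (auto simp: greedy_set_def)
  have gpos: "?g i \<ge> 0" for i using pos sub by (auto intro: less_imp_le)
  have s_eq: "?s = (\<lambda>n. \<Sum>i<n. ?g i)" by (rule ext) (rule greedy_total_eq_sum)
  have "incseq ?s" unfolding s_eq
    by (rule incseq_SucI) (use gpos in simp)
  moreover have "\<And>n. ?s n \<le> t" using greedy_total_less[OF t] less_imp_le by blast
  ultimately obtain L where L: "?s \<longlonglongrightarrow> L" and sL: "\<And>n. ?s n \<le> L"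
    using incseq_convergent by blast
  have "L \<le> t" using L by (rule LIMSEQ_le_const2) (use \<open>\<And>n. ?s n \<le> t\<close> in blast)
  have "?g sums L" using L unfolding sums_def s_eq .
  then have "(?g has_sum L) UNIV" using gpos by (rule sums_nonneg_imp_has_sum)
  then have hs: "(f has_sum L) ?Y"
    by (rule has_sum_cong_neutral[THEN iffD1, rotated -1]) auto
  have "L = t"
  proof (rule ccontr)
    assume "L \<noteq> t"
    with \<open>L \<le> t\<close> have "t - L > 0" by simp
    with lim have "eventually (\<lambda>n. f n < t - L) sequentially" by (rule order_tendstoD(2))
    then obtain N where N: "\<And>n. n \<ge> N \<Longrightarrow> f n < t - L"
      by (auto simp: eventually_sequentially)
    have "A - ?Y \<subseteq> {..<N}"
    proof
      fix a assume a: "a \<in> A - ?Y"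
      have "\<not> a \<ge> N"
      proof
        assume "a \<ge> N"
        with N[of a] sL[of a] have "?s a + f a < t" by linarith
        with a show False by (simp add: greedy_set_def)
      qed
      then show "a \<in> {..<N}" by simp
    qed
    then have "finite (A - ?Y)" by (rule finite_subset) simp
    then have "f summable_on (A - ?Y)" by simp
    with hs have "f summable_on (?Y \<union> (A - ?Y))"
      by (intro summable_on_Un_disjoint) (auto intro: has_sum_imp_summable)
    moreover have "?Y \<union> (A - ?Y) = A" using sub by auto
    ultimately show False using div by simp
  qed
  with hs show *: "(f has_sum t) ?Y" by simp
  show "infinite ?Y"
  proof
    assume fin: "finite ?Y"
    then obtain N where N: "?Y \<subseteq> {..<N}" by (auto simp: finite_nat_iff_bounded)
    have "?s N = sum f ?Y"
      unfolding greedy_total_eq_sum using N by (simp add: sum.If_cases Int_absorb1)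
    also have "\<dots> = t" using * fin has_sum_finite has_sum_unique by blast
    finally show False using greedy_total_less[OF t, of f A N] by simp
  qed
qed

section \<open>Exhausting a divergent series by subseries of equal sum\<close>

text \<open>One removal step; containing the least element is what makes the iteration exhaust the set.\<close>
lemma subseries_containing_least:
  fixes f :: "nat \<Rightarrow> real"
  assumes pos: "\<And>a. a \<in> A \<Longrightarrow> f a > 0"
    and lt: "\<And>a. a \<in> A \<Longrightarrow> f a < t"
    and lim: "f \<longlonglongrightarrow> 0"
    and div: "\<not> f summable_on A"
  obtains Y where "Y \<subseteq> A" "Inf A \<in> Y" "infinite Y" "(f has_sum t) Y" "\<not> f summable_on (A - Y)"
proof -
  let ?m = "Inf A"
  have "A \<noteq> {}" using div by auto
  then have m: "?m \<in> A" by (rule Inf_nat_def1)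
  then have insA: "insert ?m (A - {?m}) = A" by auto
  then have "\<not> f summable_on (A - {?m})"
    using div summable_on_insert_iff[of f ?m "A - {?m}"] by simp
  then obtain Z where Z: "Z \<subseteq> A - {?m}" "infinite Z" "(f has_sum (t - f ?m)) Z"
    using subseries_with_prescribed_sum[of "A - {?m}" f "t - f ?m"] pos lim lt[OF m]
    by (metis DiffD1 diff_gt_0_iff_gt)
  let ?Y = "insert ?m Z"
  have "(f has_sum (f ?m + (t - f ?m))) ?Y"
    using Z by (intro has_sum_insert) auto
  then have Y: "(f has_sum t) ?Y" by simp
  have sub: "?Y \<subseteq> A" using Z m by auto
  have "\<not> f summable_on (A - ?Y)"
  proof
    assume "f summable_on (A - ?Y)"
    with Y have "f summable_on (?Y \<union> (A - ?Y))"
      by (intro summable_on_Un_disjoint) (auto intro: has_sum_imp_summable)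
    moreover have "?Y \<union> (A - ?Y) = A" using sub by auto
    ultimately show False using div by simp
  qed
  with Y sub Z(2) show thesis by (intro that[of ?Y]) auto
qed

theorem partition_into_subseries_of_equal_sum:
  fixes f :: "nat \<Rightarrow> real"
  assumes pos: "\<And>a. a \<in> A \<Longrightarrow> f a > 0"
    and lt: "\<And>a. a \<in> A \<Longrightarrow> f a < t"
    and lim: "f \<longlonglongrightarrow> 0"
    and div: "\<not> f summable_on A"
  obtains P where "partition_on A P" "infinite P" "\<And>Y. Y \<in> P \<Longrightarrow> infinite Y \<and> (f has_sum t) Y"
proof -
  have "\<exists>Y. Y \<subseteq> B \<and> Inf B \<in> Y \<and> infinite Y \<and> (f has_sum t) Y \<and> \<not> f summable_on (B - Y)"
    if "B \<subseteq> A" "\<not> f summable_on B" for B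
    using subseries_containing_least[of B f t] that pos lt lim by (metis subsetD)
  then obtain F where F: "\<And>B. B \<subseteq> A \<Longrightarrow> \<not> f summable_on B \<Longrightarrow>
      F B \<subseteq> B \<and> Inf B \<in> F B \<and> infinite (F B) \<and> (f has_sum t) (F B) \<and> \<not> f summable_on (B - F B)"
    by metis
  define R where "R i = ((\<lambda>B. B - F B) ^^ i) A" for i :: nat
  define Y where "Y i = F (R i)" for i
  have R0: "R 0 = A" and RSuc: "R (Suc i) = R i - Y i" for i
    by (simp_all add: R_def Y_def)
  have R: "R i \<subseteq> A \<and> \<not> f summable_on R i" for i
    by (induction i) (use div F in \<open>auto simp: R0 RSuc Y_def\<close>)
  have Y: "Y i \<subseteq> R i" "Inf (R i) \<in> Y i" "infinite (Y i)" "(f has_sum t) (Y i)" for i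
    using F[of "R i"] R[of i] by (auto simp: Y_def)
  have anti: "R j \<subseteq> R i" if "i \<le> j" for i j
    using that by (induction rule: dec_induct) (auto simp: RSuc)
  have disj: "Y i \<inter> Y j = {}" if "i < j" for i j
    using anti[of "Suc i" j] that Y(1)[of j] by (auto simp: RSuc)
  have disj': "Y i \<inter> Y j = {}" if "i \<noteq> j" for i j
    using disj[of i j] disj[of j i] that by (cases "i < j") auto
  have "inj Y"
  proof (rule injI)
    fix i j assume "Y i = Y j"
    then show "i = j" using disj'[of i j] Y(3)[of i] by (cases "i = j") auto
  qed
  \<comment> \<open>Every step removes the least remaining number, so after \<open>i\<close> steps nothing below \<open>i\<close> is left.\<close>
  have low: "i \<le> x" if "x \<in> R i" for i x
    using that
  proof (induction i arbitrary: x)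
    case (Suc i)
    then have x: "x \<in> R i" "x \<notin> Y i" by (auto simp: RSuc)
    have "Inf (R i) \<in> R i" using Y(1,2) by blast
    then have "i \<le> Inf (R i)" by (rule Suc.IH)
    moreover have "Inf (R i) \<le> x" using x by (simp add: cInf_lower)
    moreover have "Inf (R i) \<noteq> x" using x Y(2)[of i] by auto
    ultimately show ?case by simp
  qed simp
  have rest: "x \<in> R i" if "x \<in> A" "x \<notin> \<Union>(range Y)" for i x
    by (induction i) (use that in \<open>auto simp: R0 RSuc\<close>)
  have "\<Union>(range Y) = A"
  proof
    show "\<Union>(range Y) \<subseteq> A" using Y(1) R by blast
    show "A \<subseteq> \<Union>(range Y)"
    proof (rule subsetI, rule ccontr)
      fix x assume "x \<in> A" "x \<notin> \<Union>(range Y)"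
      from low[OF rest[OF this, of "Suc x"]] show False by simp
    qed
  qed
  then have "partition_on A (range Y)"
  proof (rule partition_onI)
    fix p q assume "p \<in> range Y" "q \<in> range Y" "p \<noteq> q"
    then show "disjnt p q" using disj' unfolding disjnt_def by (metis rangeE)
  next
    show "{} \<notin> range Y" using Y(2) by (metis empty_iff imageE)
  qed
  moreover have "infinite (range Y)" using \<open>inj Y\<close> by (simp add: finite_image_iff)
  ultimately show thesis using that[of "range Y"] Y(3,4) by blast
qed

section \<open>Reciprocals\<close>

lemma recip_sum_eqI:
  assumes "((\<lambda>y. 1 / real y) has_sum t) Y"
  shows "recip_sum Y = ennreal t"
  unfolding recip_sum_def
proof (rule infsumI)
  have "((\<lambda>F. ennreal (\<Sum>y\<in>F. 1 / real y)) \<longlongrightarrow> ennreal t) (finite_subsets_at_top Y)"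
    using assms unfolding has_sum_def by (rule tendsto_ennrealI)
  moreover have "(\<lambda>F. ennreal (\<Sum>y\<in>F. 1 / real y)) = sum (\<lambda>y. ennreal (1 / real y))"
    by (rule ext, rule sum_ennreal[symmetric]) simp
  ultimately show "((\<lambda>y. ennreal (1 / real y)) has_sum ennreal t) Y"
    unfolding has_sum_def by simp
qed

lemma not_summable_on_reciprocals: "\<not> (\<lambda>n. 1 / real n) summable_on {M..}"
proof
  assume "(\<lambda>n. 1 / real n) summable_on {M..}"
  then have "(\<lambda>n. 1 / real n) summable_on ({..<M} \<union> {M..})"
    by (intro summable_on_Un_disjoint) auto
  moreover have "{..<M} \<union> {M..} = UNIV" by auto
  ultimately have "summable (\<lambda>n. 1 / real n)"
    by (simp add: summable_on_imp_summable)
  then show False using not_summable_harmonic[where 'a = real] by (simp add: inverse_eq_divide)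
qed

theorem theorem2:
  fixes k n d :: nat
  assumes "k > 0" and "n > 0" and "d > 0" and "coprime n d"
  shows "\<exists>P. partition_on {2 * k * d..} P \<and> infinite P \<and>
    (\<forall>Y\<in>P. infinite Y \<and> recip_sum Y = ennreal (real n / real d))"
proof -
  have bounds: "1 / real a > 0 \<and> 1 / real a < real n / real d" if "a \<in> {2 * k * d..}" for a
  proof -
    have "1 * d < 2 * k * d" using assms by (intro mult_strict_right_mono) auto
    with that have "d < a" unfolding atLeast_iff mult_1 by (rule less_le_trans[rotated])
    then have "1 / real a < 1 / real d" using \<open>d > 0\<close> by (intro divide_strict_left_mono) auto
    also have "\<dots> \<le> real n / real d" using \<open>n > 0\<close> by (intro divide_right_mono) auto
    finally show ?thesis using \<open>d < a\<close> by simp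
  qed
  obtain P where "partition_on {2 * k * d..} P" "infinite P"
    "\<And>Y. Y \<in> P \<Longrightarrow> infinite Y \<and> ((\<lambda>a. 1 / real a) has_sum (real n / real d)) Y"
    using partition_into_subseries_of_equal_sum[of "{2 * k * d..}" "\<lambda>a. 1 / real a" "real n / real d"]
      bounds lim_1_over_n not_summable_on_reciprocals by blast
  then show ?thesis using recip_sum_eqI by blast
qed

end
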